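(* Let $\mathcal M$ be an oriented matroid on the finite ground set $E$ with lattice of flats $L(M)$, let $P$ be a tope of $\mathcal M$ with Las Vergnas face lattice $L(P)\subseteq L(M)$, and let $\mathcal G$ be an arbitrary building set in $L(M)$. Then the matroid amplitude $\mathcal A(P)$ is obtained from the nestoid amplitude $A(L(P),\mathcal G\cap L(P))$ by the substitution $s_f=\sum_{e\in f}a_e$.
   Context: An oriented matroid $\mathcal M$ on $E$ is given by its set $\mathcal V$ of sign vectors $v:E\to\{-,0,+\}$ satisfying the usual covector axioms. A tope is a vector $P\in\mathcal V$ with inclusion-maximal support. For $v\in\mathcal V$ the flat of $v$ is $f_v=\{e\in E\mid v(e)=0\}$; $L(M)=\{f_v\mid v\in\mathcal V\}$, ordered by inclusion, is the lattice of flats of the underlying matroid $M$. For a tope $P$, $L(P):=\{f_v\mid v\in\mathcal V,\ v(e)=P(e)\text{ whenever }v(e)\ne0\}$, ordered by inclusion; it is a lattice with minimum $\hat 0=f_P$ and maximum $\hat 1=E$. A building set in a finite lattice $L$ is a subset $\mathcal G\subseteq L_{>\hat 0}$ with $\hat 1\in\mathcal G$ such that for every $f\in L_{>\hat 0}\setminus\mathcal G$, the interval $[\hat 0,f]$ is the product lattice $[\hat 0,g_1]\times\dots\times[\hat 0,g_k]$ (via join), where $g_1,\dots,g_k$ are the maximal elements of $\mathcal G$ below $f$. A subset $N\subseteq\mathcal G$ is nested if for all $k\ge2$ and pairwise incomparable $f_1,\dots,f_k\in N$, $f_1\vee\dots\vee f_k\notin\mathcal G$. The nestoid amplitude is $$A(L,\mathcal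 G)=\sum_{N}\ \prod_{f\in N\setminus\{\hat 1\}}\frac1{s_f},$$ the sum over the maximal nested sets $N$ of $\mathcal G$; for $A(L(P),\mathcal G\cap L(P))$ nestedness (joins) is taken in the lattice $L(P)$. The matroid amplitude $\mathcal A(P)$ is the Laplace transform of the positive nested set fan of $P$ modulo the vector $\sum_{e\in E}e$; it does not depend on the choice of building set, and for the maximal building set $L(M)\setminus\{\hat 0\}$ it reads $$\mathcal A(P)=\sum_{\hat 0<f_1<\dots<f_{r-1}<\hat 1}\ \prod_{i=1}^{r-1}\frac1{\sum_{e\in f_i}a_e},$$ the sum over all maximal chains of $L(P)$, a rational function in variables $a_e$, $e\in E$.
   Formalization: The oriented matroid is assumed to have no loops; with loops the identity fails (e.g. the Boolean oriented matroid on three elements plus one loop, with building set the atoms and the top). The finite ground set is taken to be linearly ordered, which is no restriction. *)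

theory Defs
  imports
    Complex_Main
    "HOL-Algebra.Complete_Lattice"
    "HOL-Library.FuncSet"
    "HOL-Library.Poly_Mapping"
    "HOL-Computational_Algebra.Fraction_Field"
begin

section \<open>Oriented matroids, given by covectors\<close>

text \<open>
  The signs \<open>-, 0, +\<close> are the integers \<open>-1, 0, 1\<close>. A sign vector on \<open>E\<close> is a total function
  that vanishes outside \<open>E\<close>, so that two sign vectors on \<open>E\<close> are equal iff they agree on \<open>E\<close>.
\<close>

definition sign_vectors :: "'e set \<Rightarrow> ('e \<Rightarrow> int) set" where
  "sign_vectors E = {v. (\<forall>e\<in>E. v e \<in> {-1, 0, 1}) \<and> (\<forall>e. e \<notin> E \<longrightarrow> v e = 0)}"

definition sv_comp :: "('e \<Rightarrow> int) \<Rightarrow> ('e \<Rightarrow> int) \<Rightarrow> 'e \<Rightarrow> int" where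
  "sv_comp v w = (\<lambda>e. if v e \<noteq> 0 then v e else w e)"

definition separation :: "('e \<Rightarrow> int) \<Rightarrow> ('e \<Rightarrow> int) \<Rightarrow> 'e set" where
  "separation v w = {e. v e \<noteq> 0 \<and> v e = - w e}"

locale oriented_matroid =
  fixes E :: "'e set" and V :: "('e \<Rightarrow> int) set"
  assumes finite_ground: "finite E"
    and covectors: "V \<subseteq> sign_vectors E"
    and zero_covector: "(\<lambda>_. 0) \<in> V"
    and uminus_covector: "v \<in> V \<Longrightarrow> (\<lambda>e. - v e) \<in> V"
    and comp_covector: "v \<in> V \<Longrightarrow> w \<in> V \<Longrightarrow> sv_comp v w \<in> V"
    and covector_elimination:
      "v \<in> V \<Longrightarrow> w \<in> V \<Longrightarrow> e \<in> separation v w \<Longrightarrow>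
        \<exists>z\<in>V. z e = 0 \<and> (\<forall>f\<in>E - separation v w. z f = sv_comp v w f)"

definition sv_support :: "('e \<Rightarrow> int) \<Rightarrow> 'e set" where
  "sv_support v = {e. v e \<noteq> 0}"

definition tope :: "('e \<Rightarrow> int) set \<Rightarrow> ('e \<Rightarrow> int) \<Rightarrow> bool" where
  "tope V P \<longleftrightarrow> P \<in> V \<and> \<not> (\<exists>v\<in>V. sv_support P \<subset> sv_support v)"

text \<open>A loop is an element on which every covector vanishes.\<close>

definition loopless :: "'e set \<Rightarrow> ('e \<Rightarrow> int) set \<Rightarrow> bool" where
  "loopless E V \<longleftrightarrow> (\<forall>e\<in>E. \<exists>v\<in>V. v e \<noteq> 0)"

definition flat_of :: "'e set \<Rightarrow> ('e \<Rightarrow> int) \<Rightarrow> 'e set" where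
  "flat_of E v = {e \<in> E. v e = 0}"


section \<open>The lattice of flats and the Las Vergnas face lattice\<close>

definition inclusion_order :: "'a set set \<Rightarrow> 'a set gorder" where
  "inclusion_order F = \<lparr>carrier = F, eq = (=), le = (\<subseteq>)\<rparr>"

definition flat_lattice :: "'e set \<Rightarrow> ('e \<Rightarrow> int) set \<Rightarrow> 'e set gorder" where
  "flat_lattice E V = inclusion_order (flat_of E ` V)"

definition face_lattice :: "'e set \<Rightarrow> ('e \<Rightarrow> int) set \<Rightarrow> ('e \<Rightarrow> int) \<Rightarrow> 'e set gorder" where
  "face_lattice E V P =
    inclusion_order (flat_of E ` {v \<in> V. \<forall>e\<in>E. v e \<noteq> 0 \<longrightarrow> v e = P e})"


section \<open>Building sets, nested sets and the nestoid amplitude\<close>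

definition max_below :: "('a, 'b) gorder_scheme \<Rightarrow> 'a set \<Rightarrow> 'a \<Rightarrow> 'a set" where
  "max_below L G f =
    {g \<in> G. g \<sqsubseteq>\<^bsub>L\<^esub> f \<and> \<not> (\<exists>h\<in>G. h \<sqsubseteq>\<^bsub>L\<^esub> f \<and> g \<sqsubset>\<^bsub>L\<^esub> h)}"

text \<open>
  The interval \<open>[\<bottom>, f]\<close> is the product of the intervals \<open>[\<bottom>, g]\<close>, \<open>g \<in> S\<close>, via join: taking the join of
  a tuple \<open>x\<close> with \<open>x g \<in> [\<bottom>, g]\<close> is an isomorphism from the product order onto \<open>[\<bottom>, f]\<close>.
\<close>

definition interval_product :: "('a, 'b) gorder_scheme \<Rightarrow> 'a \<Rightarrow> 'a set \<Rightarrow> bool" where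
  "interval_product L f S \<longleftrightarrow>
    bij_betw (\<lambda>x. \<Squnion>\<^bsub>L\<^esub>(x ` S)) (\<Pi>\<^sub>E g\<in>S. \<lbrace>\<bottom>\<^bsub>L\<^esub>..g\<rbrace>\<^bsub>L\<^esub>) \<lbrace>\<bottom>\<^bsub>L\<^esub>..f\<rbrace>\<^bsub>L\<^esub> \<and>
    (\<forall>x \<in> (\<Pi>\<^sub>E g\<in>S. \<lbrace>\<bottom>\<^bsub>L\<^esub>..g\<rbrace>\<^bsub>L\<^esub>). \<forall>y \<in> (\<Pi>\<^sub>E g\<in>S. \<lbrace>\<bottom>\<^bsub>L\<^esub>..g\<rbrace>\<^bsub>L\<^esub>).
      \<Squnion>\<^bsub>L\<^esub>(x ` S) \<sqsubseteq>\<^bsub>L\<^esub> \<Squnion>\<^bsub>L\<^esub>(y ` S) \<longleftrightarrow> (\<forall>g\<in>S. x g \<sqsubseteq>\<^bsub>L\<^esub> y g))"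

definition building_set :: "('a, 'b) gorder_scheme \<Rightarrow> 'a set \<Rightarrow> bool" where
  "building_set L G \<longleftrightarrow>
    G \<subseteq> carrier L - {\<bottom>\<^bsub>L\<^esub>} \<and> \<top>\<^bsub>L\<^esub> \<in> G \<and>
    (\<forall>f \<in> carrier L - {\<bottom>\<^bsub>L\<^esub>} - G. interval_product L f (max_below L G f))"

text \<open>The condition \<open>card F \<ge> 2\<close> includes finiteness of \<open>F\<close>.\<close>

definition nested_set :: "('a, 'b) gorder_scheme \<Rightarrow> 'a set \<Rightarrow> 'a set \<Rightarrow> bool" where
  "nested_set L G N \<longleftrightarrow>
    N \<subseteq> G \<and>
    (\<forall>F \<subseteq> N. card F \<ge> 2 \<and> (\<forall>f\<in>F. \<forall>g\<in>F. f \<noteq> g \<longrightarrow> \<not> f \<sqsubseteq>\<^bsub>L\<^esub> g) \<longrightarrow> \<Squnion>\<^bsub>L\<^esub>F \<notin> G)"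

definition maximal_nested_set :: "('a, 'b) gorder_scheme \<Rightarrow> 'a set \<Rightarrow> 'a set \<Rightarrow> bool" where
  "maximal_nested_set L G N \<longleftrightarrow> nested_set L G N \<and> \<not> (\<exists>N'. nested_set L G N' \<and> N \<subset> N')"

text \<open>
  The amplitudes are rational expressions in the variables \<open>s\<close> resp. \<open>a\<close>; they are defined for
  arbitrary values of the variables in a field. Indeterminates of a field of rational functions as
  values give the amplitudes as rational functions, and substitution is change of the values.
\<close>

definition nestoid_amplitude ::
    "('a, 'b) gorder_scheme \<Rightarrow> 'a set \<Rightarrow> ('a \<Rightarrow> 'k::field) \<Rightarrow> 'k" where
  "nestoid_amplitude L G s =
    (\<Sum>N | maximal_nested_set L G N. \<Prod>f \<in> N - {\<top>\<^bsub>L\<^esub>}. 1 / s f)"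


section \<open>The matroid amplitude\<close>

text \<open>
  This is the expression of the amplitude by the maximal building set, so the sum runs over the
  maximal chains of the face lattice of \<open>P\<close>. A maximal chain contains \<open>\<bottom>\<close> and \<open>\<top>\<close>, which carry no
  factor.
\<close>

definition matroid_amplitude ::
    "'e set \<Rightarrow> ('e \<Rightarrow> int) set \<Rightarrow> ('e \<Rightarrow> int) \<Rightarrow> ('e \<Rightarrow> 'k::field) \<Rightarrow> 'k" where
  "matroid_amplitude E V P a =
    (let L = face_lattice E V P in
      \<Sum>C | pred_on.maxchain (carrier L) (lless L) C.
        \<Prod>f \<in> C - {\<bottom>\<^bsub>L\<^esub>, \<top>\<^bsub>L\<^esub>}. 1 / (\<Sum>e\<in>f. a e))"

text \<open>
  Polynomials over the rationals in variables indexed by \<open>'e\<close> are finitely supported functions from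
  monomials to coefficients, a monomial being the finitely supported function of its exponents.
  The library makes them an integral domain for linearly ordered \<open>'e\<close>.
\<close>

type_synonym 'e rat_fun = "(('e \<Rightarrow>\<^sub>0 nat) \<Rightarrow>\<^sub>0 rat) fract"

definition indet :: "'e::linorder \<Rightarrow> 'e rat_fun" where
  "indet e = Fract (Poly_Mapping.single (Poly_Mapping.single e 1) 1) 1"

end

theory Submission
  imports Defs "HOL-Library.Disjoint_Sets"
begin

text \<open>
  Both amplitudes turn out to be the same kind of sum, and that kind of sum obeys a recursion in
  which the building set no longer occurs.

  A chain of nonzero faces is the same as a nested set of the largest building set, all nonzero
  faces, because there the join of any antichain is again in the building set. So the matroid
  amplitude is the nestoid amplitude of the largest building set (\<open>maxchain_amplitude\<close>), and it
  suffices to show that the nestoid amplitude of the face lattice does not depend on the building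
  set when \<open>s\<close> is additive and nonzero.

  For a face \<open>f\<close> let \<open>B f\<close> be the sum of \<open>\<Prod>h\<in>N. 1 / s h\<close> over the maximal nested sets \<open>N\<close> of faces
  below \<open>f\<close>. Such an \<open>N\<close> contains all factors of \<open>f\<close>, the maximal members \<open>g\<close> of the building set below
  \<open>f\<close>; these partition \<open>f\<close>, so \<open>s f\<close> is the sum of the \<open>s g\<close>. Multiplying \<open>B f\<close> by \<open>s f\<close> therefore
  gives the sum over all pairs of an \<open>N\<close> and a factor \<open>g\<close> of the product over \<open>N - {g}\<close>. The union of
  \<open>N - {g}\<close> is a face covered by \<open>f\<close>, and \<open>N - {g}\<close> is maximal nested below it; conversely every
  maximal nested set below a lower cover of \<open>f\<close> arises from exactly one pair (\<open>remove_factor_bij\<close>).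
  Hence \<open>s f * B f\<close> is the sum of \<open>B x\<close> over the lower covers \<open>x\<close> of \<open>f\<close>, which determines \<open>B\<close> by
  induction (\<open>nested_sum_unique\<close>). For maximal chains this recursion is the removal of the top
  element; for building sets it is the shuffle identity for linear extensions of a forest.

  The recursion needs the factors to behave well in the face lattice of the tope, whereas the
  building set is given in the lattice of all flats. In the lattice of flats, the
  interval below \<open>f\<close> is the product of the intervals below its factors, and since a proper
  subflat of the closure of a point is empty, this product is realised by disjoint unions of sets
  (\<open>building_set_product_partition\<close>). The decomposition passes to faces of the tope by covector
  elimination: a covector agreeing with the tope on one summand can be made zero on the
  complementary summand, one element at a time (\<open>split_face\<close>).
\<close>

section \<open>Finite closure systems\<close>

text \<open>
  Both the flats of a loopless oriented matroid and the faces of one of its topes form such a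
  system, so that the results on nested sets can be stated for either lattice.
\<close>

locale closure_system =
  fixes E :: "'e set" and F :: "'e set set"
  assumes finite_ground: "finite E"
    and members: "F \<subseteq> Pow E"
    and empty_member: "{} \<in> F"
    and ground_member: "E \<in> F"
    and member_Int: "x \<in> F \<Longrightarrow> y \<in> F \<Longrightarrow> x \<inter> y \<in> F"
begin

definition cl :: "'e set \<Rightarrow> 'e set" where
  "cl X = \<Inter>{y \<in> F. X \<subseteq> y}"

lemma finite_members: "finite F"
  using finite_ground members by (meson finite_Pow_iff finite_subset)

lemma finite_member: "f \<in> F \<Longrightarrow> finite f"
  using finite_ground members by (meson PowD finite_subset subsetD)

lemma member_Inter:
  assumes "A \<subseteq> F" "A \<noteq> {}"
  shows "\<Inter>A \<in> F"
proof -
  have "finite A" using assms(1) finite_members finite_subset by blast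
  then show ?thesis using assms(2,1)
    by (induction rule: finite_ne_induct) (auto simp: member_Int)
qed

lemma cl_member: "X \<subseteq> E \<Longrightarrow> cl X \<in> F"
  unfolding cl_def using ground_member by (intro member_Inter) auto

lemma subset_cl: "X \<subseteq> cl X"
  unfolding cl_def by auto

lemma cl_subset: "y \<in> F \<Longrightarrow> X \<subseteq> y \<Longrightarrow> cl X \<subseteq> y"
  unfolding cl_def by auto

lemma cl_of_member: "f \<in> F \<Longrightarrow> cl f = f"
  using subset_cl cl_subset by blast

lemma Union_members_subset: "A \<subseteq> F \<Longrightarrow> \<Union>A \<subseteq> E"
  using members by auto

lemma sup_eq_cl:
  assumes "A \<subseteq> F"
  shows "\<Squnion>\<^bsub>inclusion_order F\<^esub>A = cl (\<Union>A)"
proof -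
  have Upper: "Upper (inclusion_order F) A = {u \<in> F. \<Union>A \<subseteq> u}"
    using assms unfolding Upper_def inclusion_order_def by auto
  have "x = cl (\<Union>A)" if x: "x \<in> F" "\<Union>A \<subseteq> x" "\<forall>u\<in>F. \<Union>A \<subseteq> u \<longrightarrow> x \<subseteq> u" for x
  proof
    show "cl (\<Union>A) \<subseteq> x" by (rule cl_subset[OF x(1,2)])
    show "x \<subseteq> cl (\<Union>A)"
      using x(3) cl_member[OF Union_members_subset[OF assms]] subset_cl[of "\<Union>A"] by blast
  qed
  moreover have "cl (\<Union>A) \<in> F \<and> \<Union>A \<subseteq> cl (\<Union>A) \<and> (\<forall>u\<in>F. \<Union>A \<subseteq> u \<longrightarrow> cl (\<Union>A) \<subseteq> u)"
    using cl_member[OF Union_members_subset[OF assms]] subset_cl cl_subset by simp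
  moreover have "least (inclusion_order F) x (Upper (inclusion_order F) A) \<longleftrightarrow>
      x \<in> F \<and> \<Union>A \<subseteq> x \<and> (\<forall>u\<in>F. \<Union>A \<subseteq> u \<longrightarrow> x \<subseteq> u)" for x
    unfolding least_def Upper by (simp add: inclusion_order_def Ball_def imp_conjL)
  ultimately have "least (inclusion_order F) x (Upper (inclusion_order F) A) \<longleftrightarrow> x = cl (\<Union>A)" for x
    by metis
  then show ?thesis unfolding sup_def by simp
qed

lemma top_eq: "\<top>\<^bsub>inclusion_order F\<^esub> = E"
proof -
  have "greatest (inclusion_order F) x F \<longleftrightarrow> x = E" for x
    using members ground_member unfolding greatest_def inclusion_order_def by auto
  then show ?thesis unfolding top_def by (simp add: inclusion_order_def)
qed

lemma bottom_eq: "\<bottom>\<^bsub>inclusion_order F\<^esub> = {}"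
proof -
  have "least (inclusion_order F) x F \<longleftrightarrow> x = {}" for x
    using empty_member unfolding least_def inclusion_order_def by auto
  then show ?thesis unfolding bottom_def by (simp add: inclusion_order_def)
qed

lemma nested_set_iff:
  assumes "G \<subseteq> F"
  shows "nested_set (inclusion_order F) G N \<longleftrightarrow>
    N \<subseteq> G \<and> (\<forall>S\<subseteq>N. 2 \<le> card S \<and> (\<forall>f\<in>S. \<forall>g\<in>S. f \<noteq> g \<longrightarrow> \<not> f \<subseteq> g) \<longrightarrow> cl (\<Union>S) \<notin> G)"
proof -
  have "\<Squnion>\<^bsub>inclusion_order F\<^esub>S = cl (\<Union>S)" if "N \<subseteq> G" "S \<subseteq> N" for S
    using that assms by (intro sup_eq_cl) auto
  then show ?thesis
    unfolding nested_set_def by (auto simp: inclusion_order_def)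
qed

end

section \<open>Building sets by set partitions\<close>

text \<open>
  The set-theoretic form of the product decomposition of the interval below \<open>f\<close>: the join of a
  tuple of members below the parts is their disjoint union, and conversely a member below \<open>f\<close> is
  the join of its intersections with the parts.
\<close>

definition product_partition :: "'e set set \<Rightarrow> 'e set \<Rightarrow> 'e set set \<Rightarrow> bool" where
  "product_partition F f S \<longleftrightarrow> disjoint S \<and> \<Union>S = f \<and>
    (\<forall>x. (\<forall>g\<in>S. x g \<in> F \<and> x g \<subseteq> g) \<longrightarrow> (\<Union>g\<in>S. x g) \<in> F)"

lemma product_partition_Union:
  assumes "product_partition F f S" "\<And>g. g \<in> S \<Longrightarrow> x g \<in> F \<and> x g \<subseteq> g"
  shows "(\<Union>g\<in>S. x g) \<in> F"
proof -
  have "\<forall>x. (\<forall>g\<in>S. x g \<in> F \<and> x g \<subseteq> g) \<longrightarrow> (\<Union>g\<in>S. x g) \<in> F"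
    using assms(1) unfolding product_partition_def by simp
  then show ?thesis using assms(2) by simp
qed

definition factors :: "'e set set \<Rightarrow> 'e set \<Rightarrow> 'e set set" where
  "factors G f = {g \<in> G. g \<subseteq> f \<and> (\<forall>h\<in>G. h \<subseteq> f \<longrightarrow> \<not> g \<subset> h)}"

lemma max_below_eq_factors:
  "max_below (inclusion_order F) G f = factors G f"
  unfolding max_below_def factors_def inclusion_order_def lless_def by auto

text \<open>
  The lattice-theoretic condition on a building set is replaced by its set-theoretic form, for
  all nonempty members; for a member of \<open>G\<close>, its own only factor, it holds trivially.
\<close>

locale building_family = closure_system E F for E :: "'e set" and F +
  fixes G :: "'e set set"
  assumes building: "G \<subseteq> F - {{}}"
    and product_partition: "f \<in> F \<Longrightarrow> f \<noteq> {} \<Longrightarrow> product_partition F f (factors G f)"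
begin

abbreviation nested :: "'e set set \<Rightarrow> bool" where
  "nested \<equiv> nested_set (inclusion_order F) G"

lemma nested_iff: "nested N \<longleftrightarrow>
    N \<subseteq> G \<and> (\<forall>S\<subseteq>N. 2 \<le> card S \<and> (\<forall>f\<in>S. \<forall>g\<in>S. f \<noteq> g \<longrightarrow> \<not> f \<subseteq> g) \<longrightarrow> cl (\<Union>S) \<notin> G)"
  using building by (intro nested_set_iff) auto

lemma finite_building: "finite G"
  using building finite_members finite_subset by blast

lemma nested_subset: "nested N \<Longrightarrow> M \<subseteq> N \<Longrightarrow> nested M"
  unfolding nested_iff by (meson subset_trans)

lemma nested_subset_building: "nested N \<Longrightarrow> N \<subseteq> G"
  unfolding nested_iff by blast

lemma finite_nested: "nested N \<Longrightarrow> finite N"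
  using nested_subset_building finite_building finite_subset by blast

lemma finite_nested_sets: "finite {N. nested N}"
  by (rule finite_subset[of _ "Pow G"]) (use finite_building nested_subset_building in auto)

lemma below_factor:
  assumes "g \<in> G" "g \<subseteq> f"
  shows "\<exists>t\<in>factors G f. g \<subseteq> t"
proof -
  obtain t where "t \<in> {h \<in> G. h \<subseteq> f}" "g \<subseteq> t" "\<forall>b\<in>{h \<in> G. h \<subseteq> f}. t \<subseteq> b \<longrightarrow> t = b"
    using finite_has_maximal2[of "{h \<in> G. h \<subseteq> f}" g] assms finite_building by auto
  then show ?thesis unfolding factors_def by blast
qed

lemma factorsD: "g \<in> factors G f \<Longrightarrow> g \<in> G \<and> g \<subseteq> f \<and> g \<in> F \<and> g \<noteq> {}"
  unfolding factors_def using building by blast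

lemma factors_subset: "factors G f \<subseteq> G"
  unfolding factors_def by blast

lemma Union_factors_subset: "\<Union>(factors G f) \<subseteq> f"
  unfolding factors_def by blast

lemma factors_empty: "factors G {} = {}"
  using factorsD by blast

lemma Union_factors: "f \<in> F \<Longrightarrow> \<Union>(factors G f) = f"
  using product_partition factors_empty by (cases "f = {}") (auto simp: product_partition_def)

lemma factors_disjoint: "f \<in> F \<Longrightarrow> g \<in> factors G f \<Longrightarrow> h \<in> factors G f \<Longrightarrow> g \<noteq> h \<Longrightarrow> g \<inter> h = {}"
  using product_partition factors_empty by (cases "f = {}") (auto simp: product_partition_def disjoint_def)

text \<open>
  A proper subface of \<open>f\<close> misses part of some factor \<open>t\<close>, so it lies below one of these faces; they
  bound joins and lower covers of \<open>f\<close> from above.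
\<close>

lemma shrink_factor:
  assumes "f \<in> F" "t \<in> factors G f" "z \<in> F" "z \<subseteq> t"
  shows "z \<union> \<Union>(factors G f - {t}) \<in> F"
proof -
  have "f \<noteq> {}" using assms(2) factors_empty by auto
  have "\<forall>g\<in>factors G f. (if g = t then z else g) \<in> F \<and> (if g = t then z else g) \<subseteq> g"
    using assms factorsD by auto
  then have "(\<Union>g\<in>factors G f. if g = t then z else g) \<in> F"
    by (intro product_partition_Union[OF product_partition[OF assms(1) \<open>f \<noteq> {}\<close>]]) blast
  moreover have "(\<Union>g\<in>factors G f. if g = t then z else g) = z \<union> \<Union>(factors G f - {t})"
    using assms(2) by (auto split: if_splits)
  ultimately show ?thesis by simp
qed

lemma factor_disjoint_rest:
  assumes "f \<in> F" "t \<in> factors G f"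
  shows "t \<inter> \<Union>(factors G f - {t}) = {}"
  using factors_disjoint[OF assms] by auto

text \<open>
  Joins of antichains of a nested set are disjoint unions. Each factor \<open>t\<close> of the join \<open>y\<close> is the join
  of the members of the antichain below it, as otherwise \<open>t\<close> could be shrunk within \<open>y\<close>. By
  nestedness that join, being in \<open>G\<close>, is the join of a single element, so \<open>t\<close> lies in the antichain.
\<close>

lemma nested_antichain:
  assumes N: "nested N" and S: "S \<subseteq> N" "S \<noteq> {}"
    and anti: "\<And>f g. f \<in> S \<Longrightarrow> g \<in> S \<Longrightarrow> f \<subseteq> g \<Longrightarrow> f = g"
  shows "\<Union>S \<in> F \<and> factors G (\<Union>S) = S"
proof -
  have SG: "S \<subseteq> G" using S N nested_subset_building by blast
  have SE: "\<Union>S \<subseteq> E" using SG building by (intro Union_members_subset) auto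
  define y where "y = cl (\<Union>S)"
  have yF: "y \<in> F" unfolding y_def using SE by (rule cl_member)
  have Sy: "\<Union>S \<subseteq> y" unfolding y_def by (rule subset_cl)
  have factor_in: "t \<in> S" if t: "t \<in> factors G y" for t
  proof -
    define St where "St = {s \<in> S. s \<subseteq> t}"
    define z where "z = cl (\<Union>St)"
    have tF: "t \<in> F" "t \<in> G" "t \<noteq> {}" "t \<subseteq> y" using factorsD t by auto
    have zt: "z \<subseteq> t" unfolding z_def St_def using tF by (intro cl_subset) auto
    have zF: "z \<in> F" unfolding z_def St_def using SE by (intro cl_member) auto
    have "\<Union>S \<subseteq> z \<union> \<Union>(factors G y - {t})"
    proof
      fix e assume "e \<in> \<Union>S"
      then obtain s where s: "s \<in> S" "e \<in> s" by auto
      then obtain t' where t': "t' \<in> factors G y" "s \<subseteq> t'"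
        using below_factor[of s y] SG Sy by blast
      show "e \<in> z \<union> \<Union>(factors G y - {t})"
      proof (cases "t' = t")
        case True
        then have "e \<in> \<Union>St" unfolding St_def using s t' by auto
        then show ?thesis unfolding z_def using subset_cl[of "\<Union>St"] by blast
      qed (use s t' in auto)
    qed
    then have "y \<subseteq> z \<union> \<Union>(factors G y - {t})"
      unfolding y_def using shrink_factor[OF yF t zF zt] by (intro cl_subset) (auto simp: y_def)
    then have "z = t" using zt tF(4) factor_disjoint_rest[OF yF t] by blast
    then have "cl (\<Union>St) \<in> G" using tF z_def by simp
    moreover have "St \<subseteq> N" "\<forall>f\<in>St. \<forall>g\<in>St. f \<noteq> g \<longrightarrow> \<not> f \<subseteq> g"
      using S anti unfolding St_def by auto
    ultimately have "\<not> 2 \<le> card St" using N unfolding nested_iff by blast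
    moreover have "finite St"
      using SG finite_building finite_subset unfolding St_def by fastforce
    moreover have "St \<noteq> {}"
      using \<open>z = t\<close> tF(3) cl_of_member[OF empty_member] unfolding z_def by auto
    ultimately have "card St = 1" by (metis One_nat_def Suc_leI card_gt_0_iff le_antisym not_less_eq_eq numeral_2_eq_2)
    then obtain s where s: "St = {s}" by (rule card_1_singletonE)
    then have "s \<in> S" "s \<in> F" using SG building unfolding St_def by auto
    then have "s = t" using \<open>z = t\<close> s cl_of_member unfolding z_def by simp
    then show ?thesis using \<open>s \<in> S\<close> by simp
  qed
  have "s \<in> factors G y" if "s \<in> S" for s
  proof -
    have "s \<in> G" "s \<subseteq> y" using that SG Sy by auto
    then obtain t where "t \<in> factors G y" "s \<subseteq> t" using below_factor by blast
    then show ?thesis using anti[OF that factor_in] by metis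
  qed
  then have eq: "factors G y = S" using factor_in by blast
  then have "\<Union>S = y" using Union_factors[OF yF] by simp
  then show ?thesis using eq yF by simp
qed

text \<open>
  The previous lemma, applied to the maximal elements of \<open>N\<close>: a nested set determines the face
  that it spans, and it contains the factors of this face.
\<close>

lemma nested_Union:
  assumes N: "nested N"
  shows "\<Union>N \<in> F" "factors G (\<Union>N) \<subseteq> N"
proof -
  define S where "S = {s \<in> N. \<forall>t\<in>N. s \<subseteq> t \<longrightarrow> s = t}"
  have "\<exists>t\<in>S. s \<subseteq> t" if "s \<in> N" for s
    using finite_has_maximal2[OF finite_nested[OF N] that] unfolding S_def by blast
  then have U: "\<Union>S = \<Union>N" unfolding S_def by blast
  have "\<Union>S \<in> F \<and> factors G (\<Union>S) \<subseteq> S"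
  proof (cases "S = {}")
    case True
    then show ?thesis using empty_member factors_empty by simp
  next
    case False
    then have "\<Union>S \<in> F \<and> factors G (\<Union>S) = S"
      by (intro nested_antichain[OF N]) (auto simp: S_def)
    then show ?thesis by blast
  qed
  then show "\<Union>N \<in> F" "factors G (\<Union>N) \<subseteq> N" using U unfolding S_def by auto
qed

text \<open>
  The source of all maximality arguments. If the join of an antichain in \<open>N \<union> factors G y\<close> were in \<open>G\<close>,
  it would lie below a single factor of \<open>y\<close>; an antichain of at least two elements below one
  factor cannot contain any factor, so it would lie in \<open>N\<close>.
\<close>

lemma nested_add_factors:
  assumes N: "nested N" and y: "y \<in> F" "\<Union>N \<subseteq> y"
  shows "nested (N \<union> factors G y)"
  unfolding nested_iff
proof (intro conjI allI impI)
  show "N \<union> factors G y \<subseteq> G"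
    using nested_subset_building[OF N] factors_subset by blast
  fix S assume S: "S \<subseteq> N \<union> factors G y"
    and *: "2 \<le> card S \<and> (\<forall>f\<in>S. \<forall>g\<in>S. f \<noteq> g \<longrightarrow> \<not> f \<subseteq> g)"
  show "cl (\<Union>S) \<notin> G"
  proof
    assume G: "cl (\<Union>S) \<in> G"
    have "\<Union>S \<subseteq> y" using S y Union_factors_subset[of y] by blast
    then have "cl (\<Union>S) \<subseteq> y" by (rule cl_subset[OF y(1)])
    then obtain h where h: "h \<in> factors G y" "cl (\<Union>S) \<subseteq> h" using below_factor G by blast
    then have below: "s \<subseteq> h" if "s \<in> S" for s using that subset_cl[of "\<Union>S"] h(2) by blast
    show False
    proof (cases "h \<in> S")
      case True
      then have "S = {h}" using * below by blast
      then show False using * by simp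
    next
      case False
      have "S \<subseteq> N"
      proof
        fix s assume "s \<in> S"
        then have "s \<subset> h" using below False by blast
        then have "s \<notin> factors G y" using h unfolding factors_def by blast
        then show "s \<in> N" using S \<open>s \<in> S\<close> by blast
      qed
      then show False using N * G unfolding nested_iff by blast
    qed
  qed
qed

section \<open>The recursion for sums over maximal nested sets\<close>

definition max_nested_below :: "'e set \<Rightarrow> 'e set set set" where
  "max_nested_below f = {N. nested N \<and> \<Union>N \<subseteq> f \<and>
     (\<forall>N'. nested N' \<and> \<Union>N' \<subseteq> f \<and> N \<subseteq> N' \<longrightarrow> N' = N)}"

definition lower_covers :: "'e set \<Rightarrow> 'e set set" where
  "lower_covers f = {x \<in> F. x \<subset> f \<and> \<not> (\<exists>y\<in>F. x \<subset> y \<and> y \<subset> f)}"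

lemma factors_subset_max_nested:
  assumes "f \<in> F" "N \<in> max_nested_below f"
  shows "factors G f \<subseteq> N"
proof -
  have "nested N" "\<Union>N \<subseteq> f" using assms(2) unfolding max_nested_below_def by auto
  then have "nested (N \<union> factors G f)" "\<Union>(N \<union> factors G f) \<subseteq> f"
    using nested_add_factors[OF _ assms(1)] Union_factors_subset[of f] by auto
  then show ?thesis using assms(2) unfolding max_nested_below_def by blast
qed

lemma Union_max_nested:
  assumes "f \<in> F" "N \<in> max_nested_below f"
  shows "\<Union>N = f"
proof
  show "\<Union>N \<subseteq> f" using assms unfolding max_nested_below_def by blast
  show "f \<subseteq> \<Union>N" using factors_subset_max_nested[OF assms] Union_factors[OF assms(1)] by blast
qed

text \<open>
  A face strictly between \<open>\<Union>(N - {g})\<close> and \<open>f\<close> would contribute factors that can be added to \<open>N\<close>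
  without destroying nestedness, against the maximality of \<open>N\<close>.
\<close>

lemma remove_factor:
  assumes f: "f \<in> F" and N: "N \<in> max_nested_below f" and g: "g \<in> factors G f"
  shows "\<Union>(N - {g}) \<in> lower_covers f" "N - {g} \<in> max_nested_below (\<Union>(N - {g}))"
proof -
  define M where "M = N - {g}"
  have nN: "nested N" "\<Union>N \<subseteq> f"
    and maxN: "\<And>N'. nested N' \<Longrightarrow> \<Union>N' \<subseteq> f \<Longrightarrow> N \<subseteq> N' \<Longrightarrow> N' = N"
    using N unfolding max_nested_below_def by auto
  have tN: "factors G f \<subseteq> N" by (rule factors_subset_max_nested[OF f N])
  have nM: "nested M" using nested_subset nN(1) unfolding M_def by blast
  have Mf: "\<Union>M \<subseteq> f" using nN unfolding M_def by auto
  have "g \<notin> factors G (\<Union>M)" using nested_Union(2)[OF nM] unfolding M_def by auto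
  then have "\<Union>M \<noteq> f" using g by auto
  \<comment> \<open>The factors of \<open>y\<close> already lie in \<open>N\<close> by maximality, and \<open>g\<close> is not among them because
    \<open>y\<close> contains all other factors of \<open>f\<close>.\<close>
  have tight: "y \<subseteq> \<Union>M" if y: "y \<in> F" "\<Union>M \<subseteq> y" "y \<subseteq> f" "y \<noteq> f" for y
  proof -
    have "nested (M \<union> factors G y \<union> factors G f)"
      using nM y f Union_factors_subset[of y] Mf by (intro nested_add_factors) auto
    moreover have "\<Union>(M \<union> factors G y \<union> factors G f) \<subseteq> f" using Mf y Union_factors_subset[of y] Union_factors_subset[of f] by auto
    moreover have "N \<subseteq> M \<union> factors G y \<union> factors G f" using g unfolding M_def by auto
    ultimately have tyN: "factors G y \<subseteq> N" using maxN by blast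
    have "g \<notin> factors G y"
    proof
      assume "g \<in> factors G y"
      then have "g \<subseteq> y" using factorsD by blast
      moreover have "\<Union>(factors G f - {g}) \<subseteq> y" using tN y(2) unfolding M_def by blast
      ultimately have "\<Union>(factors G f) \<subseteq> y" by blast
      then show False using Union_factors[OF f] y by blast
    qed
    then have "factors G y \<subseteq> M" using tyN unfolding M_def by blast
    then show ?thesis using Union_factors[OF y(1)] by blast
  qed
  show "\<Union>(N - {g}) \<in> lower_covers f"
    unfolding lower_covers_def M_def[symmetric]
    using nested_Union(1)[OF nM] Mf \<open>\<Union>M \<noteq> f\<close> tight by blast
  show "N - {g} \<in> max_nested_below (\<Union>(N - {g}))"
    unfolding max_nested_below_def M_def[symmetric]
  proof (intro CollectI conjI allI impI nM order_refl)
    fix N' assume N': "nested N' \<and> \<Union>N' \<subseteq> \<Union>M \<and> M \<subseteq> N'"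
    then have N'f: "\<Union>N' \<subseteq> f" using Mf by (meson subset_trans)
    then have "nested (N' \<union> factors G f)" using N' N'f f by (intro nested_add_factors) auto
    moreover have "\<Union>(N' \<union> factors G f) \<subseteq> f" using N'f Union_factors_subset[of f] by auto
    moreover have "N \<subseteq> N' \<union> factors G f" using N' g unfolding M_def by blast
    ultimately have "N' \<subseteq> N" using maxN by blast
    moreover have "g \<notin> N'"
    proof
      assume "g \<in> N'"
      then have "\<Union>(factors G f) \<subseteq> \<Union>M" using N' tN unfolding M_def by blast
      then show False using Union_factors[OF f] Mf \<open>\<Union>M \<noteq> f\<close> by blast
    qed
    ultimately show "N' = M" using N' unfolding M_def by blast
  qed
qed

text \<open>
  A lower cover \<open>x\<close> of \<open>f\<close> contains all factors of \<open>f\<close> but one, since shrinking a single factor \<open>g\<close> not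
  below \<open>x\<close> already gives a proper subface of \<open>f\<close> above \<open>x\<close>. The factors below \<open>x\<close> are then factors
  of \<open>x\<close> and lie in \<open>M\<close>, so only \<open>g\<close> has to be added.
\<close>

lemma add_factor:
  assumes f: "f \<in> F" and x: "x \<in> lower_covers f" and M: "M \<in> max_nested_below x"
  shows "\<exists>N\<in>max_nested_below f. \<exists>g\<in>factors G f. M = N - {g}"
proof -
  have xF: "x \<in> F" "x \<subset> f" and cov: "\<And>y. y \<in> F \<Longrightarrow> x \<subseteq> y \<Longrightarrow> y \<subseteq> f \<Longrightarrow> y \<noteq> f \<Longrightarrow> y = x"
    using x unfolding lower_covers_def by blast+
  have nM: "nested M" and maxM: "\<And>N'. nested N' \<Longrightarrow> \<Union>N' \<subseteq> x \<Longrightarrow> M \<subseteq> N' \<Longrightarrow> N' = M"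
    using M unfolding max_nested_below_def by auto
  have Mx: "\<Union>M = x" by (rule Union_max_nested[OF xF(1) M])
  have below: "h \<in> M" if h: "h \<in> factors G f" "h \<subseteq> x" for h
  proof -
    obtain t where t: "t \<in> factors G x" "h \<subseteq> t" using below_factor h factorsD by metis
    then have "t \<in> G" "t \<subseteq> f" using factorsD[OF t(1)] xF by auto
    then have "h = t" using t(2) h(1) unfolding factors_def by blast
    then show ?thesis using t factors_subset_max_nested[OF xF(1) M] by blast
  qed
  have "\<not> factors G f \<subseteq> M" using Union_factors[OF f] Mx xF by blast
  then obtain g where g: "g \<in> factors G f" "g \<notin> M" by blast
  have gx: "\<not> g \<subseteq> x" using below g by blast
  \<comment> \<open>\<open>y\<close> lies between \<open>x\<close> and \<open>f\<close> and does not contain \<open>g\<close>, so it equals the lower cover \<open>x\<close>.\<close>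
  define y where "y = (x \<inter> g) \<union> \<Union>(factors G f - {g})"
  have gF: "g \<in> F" "g \<subseteq> f" using factorsD g by auto
  have "y \<in> F" unfolding y_def
    by (rule shrink_factor[OF f g(1)]) (use member_Int xF gF in auto)
  moreover have "x \<subseteq> y" using xF Union_factors[OF f] unfolding y_def by blast
  moreover have "y \<subseteq> f" using gF Union_factors_subset[of f] unfolding y_def by blast
  moreover have "y \<noteq> f" using gF gx factor_disjoint_rest[OF f g(1)] unfolding y_def by blast
  ultimately have "y = x" using cov by blast
  then have others: "factors G f - {g} \<subseteq> M" using below unfolding y_def by blast
  define N where "N = insert g M"
  have N_eq: "N = M \<union> factors G f" using others g unfolding N_def by blast
  have MN: "M = N - {g}" using g unfolding N_def by blast
  have "nested N" unfolding N_eq using nM f Mx xF by (intro nested_add_factors) auto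
  moreover have "\<Union>N \<subseteq> f" unfolding N_def using Mx xF gF by auto
  moreover have "N' = N" if N': "nested N'" "\<Union>N' \<subseteq> f" "N \<subseteq> N'" for N'
  proof -
    have n: "nested (N' - {g})" using nested_subset N'(1) by blast
    have "g \<notin> factors G (\<Union>(N' - {g}))" using nested_Union(2)[OF n] by blast
    then have "\<Union>(N' - {g}) \<noteq> f" using g by auto
    moreover have "x \<subseteq> \<Union>(N' - {g})" using MN N'(3) Mx by blast
    ultimately have "\<Union>(N' - {g}) = x"
      using cov nested_Union(1)[OF n] N'(2) by blast
    then have "N' - {g} = M" using maxM[OF n] MN N'(3) by blast
    then show ?thesis using N'(3) unfolding N_def by blast
  qed
  ultimately have "N \<in> max_nested_below f" unfolding max_nested_below_def by blast
  then show ?thesis using g(1) MN by blast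
qed

text \<open>
  Injectivity holds because \<open>N\<close> contains all factors of \<open>f\<close>: the removed factor is the only one
  that is missing from the image.
\<close>

lemma remove_factor_bij:
  assumes f: "f \<in> F"
  shows "bij_betw (\<lambda>(N, g). N - {g}) (max_nested_below f \<times> factors G f)
    (\<Union>x\<in>lower_covers f. max_nested_below x)"
  unfolding bij_betw_def
proof
  show "inj_on (\<lambda>(N, g). N - {g}) (max_nested_below f \<times> factors G f)"
  proof (rule inj_onI, clarify)
    fix N g N' g'
    assume N: "N \<in> max_nested_below f" "N' \<in> max_nested_below f"
      and g: "g \<in> factors G f" "g' \<in> factors G f" and eq: "N - {g} = N' - {g'}"
    have "factors G f \<subseteq> N" "factors G f \<subseteq> N'" using factors_subset_max_nested f N by auto
    then show "N = N' \<and> g = g'" using g eq by blast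
  qed
  show "(\<lambda>(N, g). N - {g}) ` (max_nested_below f \<times> factors G f) = (\<Union>x\<in>lower_covers f. max_nested_below x)"
    using remove_factor[OF f] add_factor[OF f] by (fastforce simp: image_iff)
qed

lemma finite_max_nested_below: "finite (max_nested_below f)"
  using finite_nested_sets by (rule finite_subset[rotated]) (auto simp: max_nested_below_def)

lemma finite_lower_covers: "finite (lower_covers f)"
  using finite_members by (rule finite_subset[rotated]) (auto simp: lower_covers_def)

lemma max_nested_below_empty: "max_nested_below {} = {{}}"
proof -
  have "N = {}" if "nested N" "\<Union>N \<subseteq> {}" for N
    using nested_subset_building[OF that(1)] that(2) building by blast
  moreover have "nested {}" unfolding nested_iff by simp
  ultimately show ?thesis unfolding max_nested_below_def by auto
qed

definition nested_sum :: "('e set \<Rightarrow> 'k::field) \<Rightarrow> 'e set \<Rightarrow> 'k" where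
  "nested_sum s f = (\<Sum>N\<in>max_nested_below f. \<Prod>h\<in>N. 1 / s h)"

text \<open>
  The maximal nested sets below different lower covers are different, as each has its face as union.
\<close>

lemma sum_remove_factor:
  assumes f: "f \<in> F"
  shows "(\<Sum>N\<in>max_nested_below f. \<Sum>g\<in>factors G f. \<Prod>h\<in>N - {g}. 1 / s h) =
    (\<Sum>x\<in>lower_covers f. nested_sum (s :: 'e set \<Rightarrow> 'k::field) x)"
proof -
  have "(\<Sum>N\<in>max_nested_below f. \<Sum>g\<in>factors G f. \<Prod>h\<in>N - {g}. 1 / s h) =
      (\<Sum>p\<in>max_nested_below f \<times> factors G f. \<Prod>h\<in>(\<lambda>(N, g). N - {g}) p. 1 / s h)"
    by (simp add: sum.cartesian_product case_prod_unfold)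
  also have "\<dots> = (\<Sum>M\<in>(\<Union>x\<in>lower_covers f. max_nested_below x). \<Prod>h\<in>M. 1 / s h)"
    by (rule sum.reindex_bij_betw[OF remove_factor_bij[OF f]])
  also have "\<dots> = (\<Sum>x\<in>lower_covers f. \<Sum>M\<in>max_nested_below x. \<Prod>h\<in>M. 1 / s h)"
  proof (rule sum.UNION_disjoint)
    show "\<forall>x\<in>lower_covers f. \<forall>y\<in>lower_covers f. x \<noteq> y \<longrightarrow> max_nested_below x \<inter> max_nested_below y = {}"
    proof (intro ballI impI equals0I)
      fix x y M assume "x \<in> lower_covers f" "y \<in> lower_covers f" "x \<noteq> y"
        and M: "M \<in> max_nested_below x \<inter> max_nested_below y"
      then have "x \<in> F" "y \<in> F" unfolding lower_covers_def by auto
      then have "\<Union>M = x" "\<Union>M = y"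
        using M Union_max_nested[of x M] Union_max_nested[of y M] by simp_all
      then show False using \<open>x \<noteq> y\<close> by simp
    qed
  qed (use finite_lower_covers finite_max_nested_below in auto)
  finally show ?thesis unfolding nested_sum_def .
qed

text \<open>
  Writing \<open>s f\<close> as the sum of the \<open>s g\<close> over the factors cancels one \<open>1 / s g\<close> in each product. The
  right-hand side involves \<open>G\<close> only through smaller sums.
\<close>

lemma nested_sum_rec:
  assumes f: "f \<in> F" and s: "\<And>g. g \<in> G \<Longrightarrow> s g \<noteq> (0 :: 'k::field)"
    and add: "s f = (\<Sum>g\<in>factors G f. s g)"
  shows "s f * nested_sum s f = (\<Sum>x\<in>lower_covers f. nested_sum s x)"
proof -
  have "s f * (\<Prod>h\<in>N. 1 / s h) = (\<Sum>g\<in>factors G f. \<Prod>h\<in>N - {g}. 1 / s h)"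
    if N: "N \<in> max_nested_below f" for N
  proof -
    have "finite N" using N finite_nested unfolding max_nested_below_def by blast
    have "s g * (\<Prod>h\<in>N. 1 / s h) = (\<Prod>h\<in>N - {g}. 1 / s h)" if g: "g \<in> factors G f" for g
    proof -
      have "g \<in> N" using factors_subset_max_nested[OF f N] g by blast
      then have "(\<Prod>h\<in>N. 1 / s h) = 1 / s g * (\<Prod>h\<in>N - {g}. 1 / s h)"
        using \<open>finite N\<close> by (simp add: prod.remove)
      moreover have "s g \<noteq> 0" using s factorsD g by blast
      ultimately show ?thesis by simp
    qed
    then show ?thesis unfolding add sum_distrib_right by simp
  qed
  then show ?thesis
    unfolding sum_remove_factor[OF f, symmetric] by (simp add: nested_sum_def sum_distrib_left)
qed

lemma factors_of_building: "f \<in> G \<Longrightarrow> factors G f = {f}"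
  unfolding factors_def by auto

text \<open>
  The top \<open>E\<close> is its own only factor, and the amplitude leaves out the contribution of \<open>E\<close>, which is
  the removal of this factor.
\<close>

lemma nestoid_amplitude_eq:
  assumes "E \<in> G"
  shows "nestoid_amplitude (inclusion_order F) G (s :: 'e set \<Rightarrow> 'k::field) = (\<Sum>x\<in>lower_covers E. nested_sum s x)"
proof -
  have below: "\<Union>N \<subseteq> E" if "nested N" for N
    using nested_subset_building[OF that] building by (intro Union_members_subset) auto
  have "{N. maximal_nested_set (inclusion_order F) G N} = max_nested_below E"
    using below unfolding maximal_nested_set_def max_nested_below_def by blast
  then show ?thesis
    unfolding nestoid_amplitude_def sum_remove_factor[OF ground_member, symmetric]
    by (simp add: factors_of_building assms top_eq)
qed

end

section \<open>Independence of the building set\<close>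

lemma (in closure_system) building_family_all: "building_family E F (F - {{}})"
proof
  fix f assume f: "f \<in> F" "f \<noteq> {}"
  then have "factors (F - {{}}) f = {f}" unfolding factors_def by auto
  then show "product_partition F f (factors (F - {{}}) f)" unfolding product_partition_def by simp
qed simp

text \<open>
  Both sums obey \<open>nested_sum_rec\<close>, start with \<open>1\<close> at the empty face, and the lower covers depend on
  \<open>F\<close> alone; as \<open>s f\<close> is nonzero, the recursion can be solved for the sum at \<open>f\<close>.
\<close>

lemma nested_sum_unique:
  assumes A: "building_family E F A" and B: "building_family E F B"
    and s: "\<And>f. f \<in> F \<Longrightarrow> f \<noteq> {} \<Longrightarrow> s f \<noteq> (0 :: 'k::field)"
    and add: "\<And>f S. finite f \<Longrightarrow> \<Union>S = f \<Longrightarrow> disjoint S \<Longrightarrow> s f = (\<Sum>g\<in>S. s g)"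
    and f: "f \<in> F"
  shows "building_family.nested_sum F A s f = building_family.nested_sum F B s f"
proof -
  interpret A: building_family E F A by (rule A)
  interpret B: building_family E F B by (rule B)
  show ?thesis using f
  proof (induction "card f" arbitrary: f rule: less_induct)
    case less
    show ?case
    proof (cases "f = {}")
      case True
      then show ?thesis
        by (simp add: A.nested_sum_def B.nested_sum_def A.max_nested_below_empty B.max_nested_below_empty)
    next
      case False
      have fin: "finite f" using less A.finite_member by blast
      have "s f * A.nested_sum s f = (\<Sum>x\<in>A.lower_covers f. A.nested_sum s x)"
        using s A.building add[OF fin] A.product_partition[OF less(2) False]
        by (intro A.nested_sum_rec less) (auto simp: product_partition_def)
      also have "\<dots> = (\<Sum>x\<in>A.lower_covers f. B.nested_sum s x)"
        using less(1) psubset_card_mono[OF fin]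
        by (intro sum.cong) (auto simp: A.lower_covers_def)
      also have "\<dots> = s f * B.nested_sum s f"
        using s B.building add[OF fin] B.product_partition[OF less(2) False]
        by (intro B.nested_sum_rec[symmetric] less) (auto simp: product_partition_def)
      finally show ?thesis using s[OF less(2) False] by simp
    qed
  qed
qed

lemma nestoid_amplitude_unique:
  assumes A: "building_family E F A" "E \<in> A" and B: "building_family E F B" "E \<in> B"
    and s: "\<And>f. f \<in> F \<Longrightarrow> f \<noteq> {} \<Longrightarrow> s f \<noteq> (0 :: 'k::field)"
    and add: "\<And>f S. finite f \<Longrightarrow> \<Union>S = f \<Longrightarrow> disjoint S \<Longrightarrow> s f = (\<Sum>g\<in>S. s g)"
  shows "nestoid_amplitude (inclusion_order F) A s = nestoid_amplitude (inclusion_order F) B s"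
proof -
  interpret A: building_family E F A by (rule A)
  interpret B: building_family E F B by (rule B)
  have "(\<Sum>x\<in>A.lower_covers E. A.nested_sum s x) = (\<Sum>x\<in>A.lower_covers E. B.nested_sum s x)"
    using nested_sum_unique[OF A(1) B(1), of s] s add by (intro sum.cong) (auto simp: A.lower_covers_def)
  then show ?thesis using A.nestoid_amplitude_eq[OF A(2)] B.nestoid_amplitude_eq[OF B(2)] by metis
qed

section \<open>Maximal chains as maximal nested sets\<close>

text \<open>
  The join of any nonempty set of nonempty members is a nonempty member, so nestedness forbids
  incomparable elements altogether.
\<close>

lemma (in closure_system) nested_all_iff_chain:
  "nested_set (inclusion_order F) (F - {{}}) N \<longleftrightarrow>
    N \<subseteq> F - {{}} \<and> (\<forall>x\<in>N. \<forall>y\<in>N. x \<subseteq> y \<or> y \<subseteq> x)"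
proof -
  have bd: "nested_set (inclusion_order F) (F - {{}}) N \<longleftrightarrow> N \<subseteq> F - {{}} \<and>
    (\<forall>S\<subseteq>N. 2 \<le> card S \<and> (\<forall>f\<in>S. \<forall>g\<in>S. f \<noteq> g \<longrightarrow> \<not> f \<subseteq> g) \<longrightarrow> cl (\<Union>S) \<notin> F - {{}})"
    by (rule nested_set_iff) auto
  have join: "cl (\<Union>S) \<in> F - {{}}" if "S \<subseteq> F - {{}}" "S \<noteq> {}" for S
    using that cl_member[OF Union_members_subset, of S] subset_cl[of "\<Union>S"] by blast
  show ?thesis
  proof
    assume n: "nested_set (inclusion_order F) (F - {{}}) N"
    have "x \<subseteq> y \<or> y \<subseteq> x" if "x \<in> N" "y \<in> N" for x y
    proof (rule ccontr)
      assume "\<not> (x \<subseteq> y \<or> y \<subseteq> x)"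
      then have "2 \<le> card {x, y} \<and> (\<forall>f\<in>{x,y}. \<forall>g\<in>{x,y}. f \<noteq> g \<longrightarrow> \<not> f \<subseteq> g)"
        by (auto simp: card_insert_if)
      moreover have "{x, y} \<subseteq> N" using that by auto
      ultimately have "cl (\<Union>{x, y}) \<notin> F - {{}}" using n bd by (metis (no_types, lifting))
      moreover have "N \<subseteq> F - {{}}" using n bd by simp
      then have "{x, y} \<subseteq> F - {{}}" using that by blast
      ultimately show False using join[of "{x, y}"] by simp
    qed
    moreover have "N \<subseteq> F - {{}}" using n bd by simp
    ultimately show "N \<subseteq> F - {{}} \<and> (\<forall>x\<in>N. \<forall>y\<in>N. x \<subseteq> y \<or> y \<subseteq> x)" by simp
  next
    assume c: "N \<subseteq> F - {{}} \<and> (\<forall>x\<in>N. \<forall>y\<in>N. x \<subseteq> y \<or> y \<subseteq> x)"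
    have False if S: "S \<subseteq> N" "2 \<le> card S" "\<forall>f\<in>S. \<forall>g\<in>S. f \<noteq> g \<longrightarrow> \<not> f \<subseteq> g" for S
    proof -
      obtain x y where "x \<in> S" "y \<in> S" "x \<noteq> y"
        using S(2) by (metis card_2_iff' obtain_subset_with_card_n subsetD)
      moreover have "x \<subseteq> y \<or> y \<subseteq> x" using c S(1) \<open>x \<in> S\<close> \<open>y \<in> S\<close> by blast
      ultimately show False using S(3) by blast
    qed
    then show "nested_set (inclusion_order F) (F - {{}}) N"
      unfolding bd using c by blast
  qed
qed

text \<open>
  Maximal chains contain the bottom element, nested sets never do; apart from this they agree.
\<close>

lemma (in closure_system) maxchain_amplitude:
  "(\<Sum>C | pred_on.maxchain F (\<subset>) C. \<Prod>f \<in> C - {{}, E}. 1 / s f) =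
    nestoid_amplitude (inclusion_order F) (F - {{}}) (s :: 'e set \<Rightarrow> 'k::field)"
proof -
  have chain: "pred_on.chain F (\<subset>) C \<longleftrightarrow> C \<subseteq> F \<and> (\<forall>x\<in>C. \<forall>y\<in>C. x \<subseteq> y \<or> y \<subseteq> x)" for C :: "'e set set"
    unfolding pred_on.chain_def by blast
  have chain_iff: "pred_on.chain F (\<subset>) C \<longleftrightarrow> nested_set (inclusion_order F) (F - {{}}) (C - {{}})" for C
    unfolding chain nested_all_iff_chain using empty_member by blast
  have no_bot: "nested_set (inclusion_order F) (F - {{}}) N \<Longrightarrow> {} \<notin> N" for N
    unfolding nested_all_iff_chain by blast
  have bot_in: "{} \<in> C" if "pred_on.maxchain F (\<subset>) C" for C
  proof -
    have "pred_on.chain F (\<subset>) (insert {} C)"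
      using that empty_member unfolding pred_on.maxchain_def chain by blast
    then show ?thesis using that unfolding pred_on.maxchain_def by blast
  qed
  have max1: "maximal_nested_set (inclusion_order F) (F - {{}}) (C - {{}})"
    if C: "pred_on.maxchain F (\<subset>) C" for C
    unfolding maximal_nested_set_def
  proof
    show "nested_set (inclusion_order F) (F - {{}}) (C - {{}})"
      using C unfolding pred_on.maxchain_def chain_iff by blast
    show "\<not> (\<exists>N'. nested_set (inclusion_order F) (F - {{}}) N' \<and> C - {{}} \<subset> N')"
    proof (rule notI, elim exE conjE)
      fix N' assume N': "nested_set (inclusion_order F) (F - {{}}) N'" "C - {{}} \<subset> N'"
      then have "pred_on.chain F (\<subset>) (insert {} N')" unfolding chain_iff by (simp add: no_bot)
      moreover have "C \<subset> insert {} N'" using N' no_bot[OF N'(1)] bot_in[OF C] by blast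
      ultimately show False using C unfolding pred_on.maxchain_def by blast
    qed
  qed
  have max2: "pred_on.maxchain F (\<subset>) (insert {} N)"
    if N: "maximal_nested_set (inclusion_order F) (F - {{}}) N" for N
    unfolding pred_on.maxchain_def
  proof
    show "pred_on.chain F (\<subset>) (insert {} N)"
      using N unfolding chain_iff maximal_nested_set_def by (simp add: no_bot)
    show "\<not> (\<exists>S. pred_on.chain F (\<subset>) S \<and> insert {} N \<subset> S)"
    proof (rule notI, elim exE conjE)
      fix S assume S: "pred_on.chain F (\<subset>) S" "insert {} N \<subset> S"
      have "{} \<notin> N" using N no_bot unfolding maximal_nested_set_def by blast
      then have "N \<subset> S - {{}}" using S(2) by blast
      then show False using N S(1) unfolding chain_iff maximal_nested_set_def by blast
    qed
  qed
  have "(\<Sum>C | pred_on.maxchain F (\<subset>) C. \<Prod>f \<in> C - {{}, E}. 1 / s f) =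
     (\<Sum>N | maximal_nested_set (inclusion_order F) (F - {{}}) N. \<Prod>f \<in> N - {E}. 1 / s f)"
  proof (rule sum.reindex_bij_witness[where i = "insert {}" and j = "\<lambda>C. C - {{}}"])
    fix C assume C: "C \<in> {C. pred_on.maxchain F (\<subset>) C}"
    show "insert {} (C - {{}}) = C" using C bot_in by (simp add: insert_absorb)
    show "C - {{}} \<in> {N. maximal_nested_set (inclusion_order F) (F - {{}}) N}" using C max1 by simp
    show "(\<Prod>f \<in> C - {{}} - {E}. 1 / s f) = (\<Prod>f \<in> C - {{}, E}. 1 / s f)"
      by (simp add: Diff_insert2[symmetric] insert_commute)
  next
    fix N assume N: "N \<in> {N. maximal_nested_set (inclusion_order F) (F - {{}}) N}"
    then show "insert {} N - {{}} = N" using no_bot unfolding maximal_nested_set_def by simp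
    show "insert {} N \<in> {C. pred_on.maxchain F (\<subset>) C}" using N max2 by simp
  qed
  then show ?thesis unfolding nestoid_amplitude_def top_eq .
qed

section \<open>From product intervals to partitions\<close>

text \<open>
  Injectivity of the join makes the factors disjoint and forces \<open>x g = j \<inter> g\<close> for the join \<open>j\<close> of
  a tuple \<open>x\<close>. That the factors cover \<open>f\<close> is not a lattice-theoretic fact: a point \<open>e\<close> of \<open>f\<close> lies
  in a factor because the closure of \<open>e\<close> is an atom, so that every nonempty component of its tuple
  is the whole closure.
\<close>

lemma (in closure_system) building_set_product_partition:
  assumes bs: "building_set (inclusion_order F) G"
    and atom: "\<And>e x. e \<in> E \<Longrightarrow> x \<in> F \<Longrightarrow> x \<subset> cl {e} \<Longrightarrow> x = {}"
    and f: "f \<in> F" "f \<noteq> {}"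
  shows "product_partition F f (factors G f)"
proof (cases "f \<in> G")
  case True
  then have "factors G f = {f}" unfolding factors_def by auto
  then show ?thesis unfolding product_partition_def by simp
next
  case False
  define S where "S = factors G f"
  have GF: "G \<subseteq> F" using bs unfolding building_set_def by (auto simp: inclusion_order_def)
  have SF: "S \<subseteq> F" using GF unfolding S_def factors_def by blast
  have Sf: "g \<subseteq> f" if "g \<in> S" for g using that unfolding S_def factors_def by blast
  have "interval_product (inclusion_order F) f S"
    using bs f False unfolding building_set_def bottom_eq max_below_eq_factors S_def
    by (simp add: inclusion_order_def)
  then have bij: "bij_betw (\<lambda>x. \<Squnion>\<^bsub>inclusion_order F\<^esub>(x ` S))
      (\<Pi>\<^sub>E g\<in>S. {x \<in> F. x \<subseteq> g}) {x \<in> F. x \<subseteq> f}"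
    unfolding interval_product_def bottom_eq at_least_at_most_def by (simp add: inclusion_order_def)
  have sup: "\<Squnion>\<^bsub>inclusion_order F\<^esub>(x ` S) = cl (\<Union>g\<in>S. x g)" if "x \<in> (\<Pi>\<^sub>E g\<in>S. {x \<in> F. x \<subseteq> g})" for x
    by (rule sup_eq_cl) (use that in auto)
  have inj: "u g = v g"
    if u: "\<And>g. g \<in> S \<Longrightarrow> u g \<in> F \<and> u g \<subseteq> g" and v: "\<And>g. g \<in> S \<Longrightarrow> v g \<in> F \<and> v g \<subseteq> g"
      and eq: "cl (\<Union>g\<in>S. u g) = cl (\<Union>g\<in>S. v g)" and g: "g \<in> S" for u v g
  proof -
    have r: "restrict u S \<in> (\<Pi>\<^sub>E g\<in>S. {x \<in> F. x \<subseteq> g})" "restrict v S \<in> (\<Pi>\<^sub>E g\<in>S. {x \<in> F. x \<subseteq> g})"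
      using u v by auto
    have "\<Squnion>\<^bsub>inclusion_order F\<^esub>(restrict u S ` S) = \<Squnion>\<^bsub>inclusion_order F\<^esub>(restrict v S ` S)"
      unfolding sup[OF r(1)] sup[OF r(2)] using eq by simp
    then have "restrict u S = restrict v S"
      by (rule inj_onD[OF bij_betw_imp_inj_on[OF bij] _ r])
    then show ?thesis using g by (metis restrict_apply')
  qed
  have surj: "\<exists>u. (\<forall>g\<in>S. u g \<in> F \<and> u g \<subseteq> g) \<and> cl (\<Union>g\<in>S. u g) = z" if "z \<in> F" "z \<subseteq> f" for z
  proof -
    have "z \<in> (\<lambda>x. \<Squnion>\<^bsub>inclusion_order F\<^esub>(x ` S)) ` (\<Pi>\<^sub>E g\<in>S. {x \<in> F. x \<subseteq> g})"
      using bij_betw_imp_surj_on[OF bij] that by simp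
    then obtain u where "u \<in> (\<Pi>\<^sub>E g\<in>S. {x \<in> F. x \<subseteq> g})" "z = \<Squnion>\<^bsub>inclusion_order F\<^esub>(u ` S)"
      by blast
    then show ?thesis using sup by (intro exI[of _ u]) auto
  qed
  have "disjoint S"
    unfolding disjoint_def
  proof (intro ballI impI)
    fix g h assume gh: "g \<in> S" "h \<in> S" "g \<noteq> h"
    define u where "u = (\<lambda>k. if k = g then g \<inter> h else {})"
    define v where "v = (\<lambda>k. if k = h then g \<inter> h else {})"
    have "(\<Union>k\<in>S. u k) = g \<inter> h" "(\<Union>k\<in>S. v k) = g \<inter> h"
      unfolding u_def v_def using gh by (auto split: if_splits)
    moreover have "g \<inter> h \<in> F" using gh(1,2) SF member_Int by blast
    moreover have "u k \<in> F \<and> u k \<subseteq> k" "v k \<in> F \<and> v k \<subseteq> k" for k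
      using \<open>g \<inter> h \<in> F\<close> empty_member unfolding u_def v_def by auto
    ultimately have "u g = v g"
      using gh(1) by (intro inj[of u v g]) simp_all
    then show "g \<inter> h = {}" unfolding u_def v_def using gh by simp
  qed
  moreover have "\<Union>S = f"
  proof
    show "\<Union>S \<subseteq> f" using Sf by blast
    show "f \<subseteq> \<Union>S"
    proof
      fix e assume e: "e \<in> f"
      then have eE: "e \<in> E" using f members by blast
      have ecl: "e \<in> cl {e}" using subset_cl[of "{e}"] by simp
      have "cl {e} \<in> F" using eE by (intro cl_member) simp
      moreover have "cl {e} \<subseteq> f" using e f(1) by (intro cl_subset) auto
      ultimately obtain u where u: "\<forall>g\<in>S. u g \<in> F \<and> u g \<subseteq> g" "cl (\<Union>g\<in>S. u g) = cl {e}"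
        using surj[of "cl {e}"] by blast
      have "(\<Union>g\<in>S. u g) \<noteq> {}"
        using u(2) ecl cl_of_member[OF empty_member] by (metis empty_iff)
      then obtain g where g: "g \<in> S" "u g \<noteq> {}" by blast
      have "u g \<subseteq> cl {e}" using subset_cl[of "\<Union>g\<in>S. u g"] g u by blast
      then have "u g = cl {e}" using atom[OF eE, of "u g"] g u by blast
      then show "e \<in> \<Union>S" using ecl g u by blast
    qed
  qed
  moreover have "(\<Union>g\<in>S. x g) \<in> F" if x: "\<forall>g\<in>S. x g \<in> F \<and> x g \<subseteq> g" for x
  proof -
    define j where "j = cl (\<Union>g\<in>S. x g)"
    have xf: "(\<Union>g\<in>S. x g) \<subseteq> f" using x Sf by blast
    then have jf: "j \<subseteq> f" unfolding j_def using f by (intro cl_subset)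
    have jF: "j \<in> F" unfolding j_def using xf f members by (intro cl_member) blast
    have xj: "(\<Union>g\<in>S. x g) \<subseteq> j" unfolding j_def by (rule subset_cl)
    have "cl (\<Union>g\<in>S. j \<inter> g) = j"
    proof
      show "cl (\<Union>g\<in>S. j \<inter> g) \<subseteq> j" using jF by (intro cl_subset) auto
      have "(\<Union>g\<in>S. x g) \<subseteq> (\<Union>g\<in>S. j \<inter> g)" using x xj by blast
      then have "(\<Union>g\<in>S. x g) \<subseteq> cl (\<Union>g\<in>S. j \<inter> g)" using subset_cl[of "\<Union>g\<in>S. j \<inter> g"] by (rule subset_trans)
      moreover have "cl (\<Union>g\<in>S. j \<inter> g) \<in> F" using jF members by (intro cl_member) blast
      ultimately have "cl (\<Union>g\<in>S. x g) \<subseteq> cl (\<Union>g\<in>S. j \<inter> g)" by (intro cl_subset)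
      then show "j \<subseteq> cl (\<Union>g\<in>S. j \<inter> g)" unfolding j_def .
    qed
    then have "cl (\<Union>g\<in>S. x g) = cl (\<Union>g\<in>S. j \<inter> g)" unfolding j_def by simp
    moreover have "j \<inter> g \<in> F" if "g \<in> S" for g using jF SF member_Int that by blast
    ultimately have "x g = j \<inter> g" if "g \<in> S" for g
      using x that by (intro inj[of x "\<lambda>g. j \<inter> g"]) simp_all
    then have "(\<Union>g\<in>S. x g) = j \<inter> \<Union>S" by auto
    then show ?thesis using \<open>\<Union>S = f\<close> jf jF by (simp add: Int_absorb2)
  qed
  ultimately show ?thesis unfolding product_partition_def S_def[symmetric] by blast
qed

section \<open>Flats and faces of an oriented matroid\<close>

context oriented_matroid
begin

lemma sign_cases: "v \<in> V \<Longrightarrow> e \<in> E \<Longrightarrow> v e = -1 \<or> v e = 0 \<or> v e = 1"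
  using covectors unfolding sign_vectors_def by auto

lemma flat_of_comp: "flat_of E (sv_comp v w) = flat_of E v \<inter> flat_of E w"
  unfolding flat_of_def sv_comp_def by auto

lemma flat_of_zero: "flat_of E (\<lambda>_. 0) = E"
  unfolding flat_of_def by simp

text \<open>
  Elimination in the form used below, with the signs arranged. The result is controlled wherever
  one of the two covectors vanishes, because such elements are not in the separation set.
\<close>

lemma eliminate_at:
  assumes "v \<in> V" "w \<in> V" "e \<in> E" "v e \<noteq> 0" "w e \<noteq> 0"
  shows "\<exists>z\<in>V. z e = 0 \<and> (\<forall>a\<in>E. v a = 0 \<longrightarrow> (z a = 0 \<longleftrightarrow> w a = 0)) \<and>
    (\<forall>a\<in>E. w a = 0 \<longrightarrow> z a = v a)"
proof -
  obtain w' where w': "w' \<in> V" "v e = - w' e" "\<And>a. w' a = 0 \<longleftrightarrow> w a = 0"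
  proof (cases "v e = - w e")
    case True
    then show ?thesis using that assms by blast
  next
    case False
    then have "v e = - (\<lambda>a. - w a) e" using sign_cases[of v e] sign_cases[of w e] assms by auto
    then show ?thesis using that[of "\<lambda>a. - w a"] uminus_covector[of w] assms by simp
  qed
  then have "e \<in> separation v w'" unfolding separation_def using assms by simp
  then obtain z where z: "z \<in> V" "z e = 0" "\<forall>a\<in>E - separation v w'. z a = sv_comp v w' a"
    using covector_elimination assms(1) w'(1) by blast
  have "z a = sv_comp v w' a" if "a \<in> E" "v a = 0 \<or> w a = 0" for a
    using z(3) that w'(3)[of a] unfolding separation_def by auto
  then have "\<forall>a\<in>E. v a = 0 \<longrightarrow> (z a = 0 \<longleftrightarrow> w a = 0)" "\<forall>a\<in>E. w a = 0 \<longrightarrow> z a = v a"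
    using w'(3) unfolding sv_comp_def by auto
  then show ?thesis using z by blast
qed

lemma tope_nonzero:
  assumes "loopless E V" "tope V P" "e \<in> E"
  shows "P e \<noteq> 0"
proof
  assume 0: "P e = 0"
  obtain w where w: "w \<in> V" "w e \<noteq> 0" using assms unfolding loopless_def by blast
  have "sv_support P \<subset> sv_support (sv_comp P w)"
    using 0 w unfolding sv_support_def sv_comp_def by auto
  moreover have "sv_comp P w \<in> V" using comp_covector assms(2) w unfolding tope_def by blast
  ultimately show False using assms(2) unfolding tope_def by blast
qed

lemma closure_system_flats:
  assumes "P \<in> V" "\<And>e. e \<in> E \<Longrightarrow> P e \<noteq> 0"
  shows "closure_system E (flat_of E ` V)"
proof
  show "{} \<in> flat_of E ` V"
    using assms by (intro image_eqI[of _ _ P]) (auto simp: flat_of_def)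
  show "E \<in> flat_of E ` V" using zero_covector flat_of_zero by force
  show "x \<inter> y \<in> flat_of E ` V" if "x \<in> flat_of E ` V" "y \<in> flat_of E ` V" for x y
    using that by (auto simp: flat_of_comp[symmetric] intro!: imageI comp_covector)
qed (auto simp: finite_ground flat_of_def)

definition conformal :: "('e \<Rightarrow> int) \<Rightarrow> ('e \<Rightarrow> int) set" where
  "conformal P = {v \<in> V. \<forall>e\<in>E. v e \<noteq> 0 \<longrightarrow> v e = P e}"

lemma closure_system_faces:
  assumes "P \<in> V" "\<And>e. e \<in> E \<Longrightarrow> P e \<noteq> 0"
  shows "closure_system E (flat_of E ` conformal P)"
proof
  show "{} \<in> flat_of E ` conformal P"
    using assms by (intro image_eqI[of _ _ P]) (auto simp: flat_of_def conformal_def)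
  show "E \<in> flat_of E ` conformal P"
    using zero_covector flat_of_zero unfolding conformal_def by force
  show "x \<inter> y \<in> flat_of E ` conformal P"
    if xy: "x \<in> flat_of E ` conformal P" "y \<in> flat_of E ` conformal P" for x y
  proof -
    obtain v w where vw: "v \<in> conformal P" "x = flat_of E v" "w \<in> conformal P" "y = flat_of E w"
      using xy by blast
    then have "sv_comp v w \<in> conformal P"
      using comp_covector unfolding conformal_def by (auto simp: sv_comp_def)
    then show ?thesis unfolding vw(2,4) flat_of_comp[symmetric] by (rule imageI)
  qed
qed (auto simp: finite_ground flat_of_def)

text \<open>
  If \<open>v\<close> has the zero set \<open>x\<close> with a point \<open>a\<close>, and \<open>w\<close> does not vanish at \<open>a\<close>, then neither \<open>v\<close> nor \<open>w\<close>
  vanishes at \<open>e\<close>. Eliminating \<open>e\<close> leaves a flat that contains \<open>e\<close> but not \<open>a\<close>, although \<open>a\<close> is in the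
  closure of \<open>e\<close>.
\<close>

lemma flat_below_atom:
  assumes "loopless E V" "closure_system E (flat_of E ` V)" "e \<in> E"
    and x: "x \<in> flat_of E ` V" "x \<subset> closure_system.cl (flat_of E ` V) {e}"
  shows "x = {}"
proof (rule ccontr)
  interpret closure_system E "flat_of E ` V" by fact
  assume "x \<noteq> {}"
  then obtain a where a: "a \<in> x" by blast
  obtain v where v: "v \<in> V" "x = flat_of E v" using x by blast
  have aE: "a \<in> E" "v a = 0" using a v unfolding flat_of_def by auto
  obtain w where w: "w \<in> V" "w a \<noteq> 0" using assms(1) aE unfolding loopless_def by blast
  have ve: "v e \<noteq> 0" using x cl_subset[OF x(1), of "{e}"] v assms(3) unfolding flat_of_def by blast
  have below: "e \<in> y \<Longrightarrow> y \<in> flat_of E ` V \<Longrightarrow> a \<in> y" for y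
    using cl_subset[of y "{e}"] a x by blast
  have "w e \<noteq> 0" using below[of "flat_of E w"] w assms(3) unfolding flat_of_def by blast
  then obtain z where z: "z \<in> V" "z e = 0" "z a = 0 \<longleftrightarrow> w a = 0"
    using eliminate_at[of v w e] v w ve assms(3) aE by metis
  then show False using below[of "flat_of E z"] w assms(3) unfolding flat_of_def by blast
qed

text \<open>
  The oriented part of the argument. Start with the covector of the face \<open>z\<close>, and keep its values on
  \<open>g\<close> while enlarging its zero set in \<open>h\<close>: to make it vanish at a further element \<open>e\<close> of \<open>h\<close>, eliminate
  \<open>e\<close> with a covector that vanishes on \<open>g\<close> and on all zeros reached so far. The splitting
  hypothesis provides this covector. Outside of \<open>f\<close> the values of the tope are restored by
  composition with the covector of \<open>f\<close>.
\<close>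

lemma split_face:
  assumes P: "\<And>e. e \<in> E \<Longrightarrow> P e \<noteq> 0"
    and f: "f \<in> flat_of E ` conformal P" and z: "z \<in> flat_of E ` conformal P"
    and gh: "g \<union> h = f" "g \<inter> h = {}" "z \<subseteq> g"
    and split: "\<And>x. x \<in> flat_of E ` V \<Longrightarrow> g \<union> (x \<inter> h) \<in> flat_of E ` V"
  shows "z \<union> h \<in> flat_of E ` conformal P"
proof -
  obtain u where u: "u \<in> conformal P" "f = flat_of E u" using f by blast
  have fE: "f \<subseteq> E" using u unfolding flat_of_def by auto
  \<comment> \<open>\<open>Q v\<close>: on \<open>g\<close>, \<open>v\<close> agrees with the covector of the face \<open>z\<close>. A largest zero set in \<open>h\<close> is all of \<open>h\<close>.\<close>
  define Q where "Q = (\<lambda>v. v \<in> V \<and> (\<forall>a\<in>g. v a = (if a \<in> z then 0 else P a)))"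
  obtain v0 where v0: "v0 \<in> conformal P" "z = flat_of E v0" using z by blast
  then have "Q v0" using fE gh unfolding Q_def conformal_def flat_of_def by auto
  have "finite h" using fE gh finite_ground finite_subset by blast
  have "\<exists>v. Q v \<and> (\<forall>v'. Q v' \<longrightarrow> card {a \<in> h. v' a = 0} \<le> card {a \<in> h. v a = 0})"
    using \<open>Q v0\<close> \<open>finite h\<close>
    by (intro ex_has_greatest_nat[of Q v0 _ "Suc (card h)"]) (auto simp: less_Suc_eq_le intro!: card_mono)
  then obtain v where v: "Q v"
    and v_max: "\<And>v'. Q v' \<Longrightarrow> card {a \<in> h. v' a = 0} \<le> card {a \<in> h. v a = 0}" by blast
  have v_zero: "v e = 0" if e: "e \<in> h" for e
  proof (rule ccontr)
    assume ve: "v e \<noteq> 0"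
    have eE: "e \<in> E" using e gh fE by blast
    have "g \<union> (flat_of E v \<inter> h) \<in> flat_of E ` V" using v split unfolding Q_def by blast
    then obtain w where w: "w \<in> V" "flat_of E w = g \<union> (flat_of E v \<inter> h)" by auto
    have "e \<notin> flat_of E w" unfolding w using e ve gh unfolding flat_of_def by blast
    then have "w e \<noteq> 0" using eE unfolding flat_of_def by blast
    then obtain z' where z': "z' \<in> V" "z' e = 0" "\<forall>a\<in>E. v a = 0 \<longrightarrow> (z' a = 0 \<longleftrightarrow> w a = 0)"
      "\<forall>a\<in>E. w a = 0 \<longrightarrow> z' a = v a"
      using eliminate_at[of v w e] v w ve eE unfolding Q_def by blast
    have wg: "w a = 0" if "a \<in> g" for a using w(2) that unfolding flat_of_def by blast
    have wh: "w a = 0" if "a \<in> h" "v a = 0" for a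
    proof -
      have "a \<in> flat_of E w" unfolding w(2) using that gh fE by (auto simp: flat_of_def)
      then show ?thesis unfolding flat_of_def by simp
    qed
    have gE: "g \<subseteq> E" "h \<subseteq> E" using gh fE by auto
    then have "Q z'" using v z' wg unfolding Q_def by (simp add: subset_iff)
    moreover have "{a \<in> h. v a = 0} \<subset> {a \<in> h. z' a = 0}"
      using e ve z' wh gE by auto
    then have "card {a \<in> h. v a = 0} < card {a \<in> h. z' a = 0}"
      using \<open>finite h\<close> by (intro psubset_card_mono) auto
    ultimately show False using v_max[of z'] by simp
  qed
  have "sv_comp u v \<in> conformal P"
    unfolding conformal_def
  proof (intro CollectI conjI ballI impI)
    show "sv_comp u v \<in> V" using comp_covector u v unfolding conformal_def Q_def by blast
    fix a assume a: "a \<in> E" "sv_comp u v a \<noteq> 0"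
    show "sv_comp u v a = P a"
    proof (cases "u a = 0")
      case True
      then have "a \<in> f" "v a \<noteq> 0" using a u unfolding flat_of_def sv_comp_def by auto
      then have "a \<in> g" using v_zero gh by blast
      then have "v a = P a" using v \<open>v a \<noteq> 0\<close> unfolding Q_def by (metis (full_types))
      then show ?thesis using True unfolding sv_comp_def by simp
    qed (use u a in \<open>auto simp: conformal_def sv_comp_def\<close>)
  qed
  moreover have "flat_of E (sv_comp u v) = z \<union> h"
  proof -
    have "a \<in> f \<and> v a = 0 \<longleftrightarrow> a \<in> z \<union> h" for a
    proof (cases "a \<in> g")
      case True
      then have "v a = 0 \<longleftrightarrow> a \<in> z" using v P gh fE unfolding Q_def by auto
      then show ?thesis using True gh by blast
    qed (use gh v_zero in auto)
    then show ?thesis unfolding flat_of_comp u(2)[symmetric] using fE unfolding flat_of_def by blast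
  qed
  ultimately show ?thesis by blast
qed

text \<open>
  All factors of a face \<open>f\<close> among the flats are faces of the tope: apply \<open>split_face\<close> to the empty
  face in the complement of the factor. So passing to \<open>G\<close> intersected with the faces does not change
  factors. A union of faces below the factors is an intersection of faces, in each of which
  only one factor is shrunk; these are given by \<open>split_face\<close> again.
\<close>

lemma building_family_faces:
  assumes ll: "loopless E V" and tope: "tope V P"
    and bs: "building_set (flat_lattice E V) G"
  shows "building_family E (flat_of E ` conformal P) (G \<inter> flat_of E ` conformal P)"
proof -
  let ?L = "flat_of E ` V" and ?F = "flat_of E ` conformal P"
  have P: "P \<in> V" "\<And>e. e \<in> E \<Longrightarrow> P e \<noteq> 0"
    using tope tope_nonzero[OF ll tope] unfolding tope_def by auto
  have L: "closure_system E ?L" and F: "closure_system E ?F"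
    using closure_system_flats closure_system_faces P by auto
  interpret L: closure_system E ?L by (rule L)
  interpret F: closure_system E ?F by (rule F)
  have FL: "?F \<subseteq> ?L" unfolding conformal_def by blast
  have bs': "building_set (inclusion_order ?L) G" using bs unfolding flat_lattice_def .
  interpret L: building_family E ?L G
  proof
    show "G \<subseteq> ?L - {{}}"
      using bs' unfolding building_set_def L.bottom_eq by (simp add: inclusion_order_def)
    show "product_partition ?L f (factors G f)" if "f \<in> ?L" "f \<noteq> {}" for f
      using L.building_set_product_partition[OF bs'] flat_below_atom[OF ll L] that by blast
  qed
  show ?thesis
  proof
    show "G \<inter> ?F \<subseteq> ?F - {{}}" using L.building by blast
    fix f assume f: "f \<in> ?F" "f \<noteq> {}"
    then have fL: "f \<in> ?L" using FL by blast
    define S where "S = factors G f"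
    have US: "\<Union>S = f" unfolding S_def by (rule L.Union_factors[OF fL])
    have dis: "disjoint S" using L.product_partition[OF fL f(2)] unfolding product_partition_def S_def by blast
    have SL: "g \<in> ?L" if "g \<in> S" for g using that L.factorsD unfolding S_def by blast
    have part: "g \<union> \<Union>(S - {g}) = f" "g \<inter> \<Union>(S - {g}) = {}" if "g \<in> S" for g
      using that US L.factor_disjoint_rest[OF fL] unfolding S_def by auto
    have SF: "g \<in> ?F" if g: "g \<in> S" for g
    proof -
      have "{} \<union> g \<in> ?F"
      proof (rule split_face[OF P(2) f(1) F.empty_member])
        show "\<Union>(S - {g}) \<union> g = f" "\<Union>(S - {g}) \<inter> g = {}" using part[OF g] by auto
        show "\<Union>(S - {g}) \<union> (x \<inter> g) \<in> ?L" if "x \<in> ?L" for x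
          using L.shrink_factor[OF fL g[unfolded S_def], of "x \<inter> g"] L.member_Int that SL[OF g]
          unfolding S_def by (simp add: Un_commute)
      qed auto
      then show ?thesis by simp
    qed
    have shrink: "z \<union> \<Union>(S - {g}) \<in> ?F" if g: "g \<in> S" and z: "z \<in> ?F" "z \<subseteq> g" for g z
    proof (rule split_face[OF P(2) f(1) z(1) part[OF g] z(2)])
      fix x assume x: "x \<in> ?L"
      have "(\<Union>k\<in>S. if k = g then g else x \<inter> k) \<in> ?L"
        unfolding S_def
        by (rule product_partition_Union[OF L.product_partition[OF fL f(2)]])
          (use x SL L.member_Int in \<open>auto simp: S_def[symmetric]\<close>)
      moreover have "(\<Union>k\<in>S. if k = g then g else x \<inter> k) = g \<union> (x \<inter> \<Union>(S - {g}))"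
        using g by (auto split: if_splits)
      ultimately show "g \<union> (x \<inter> \<Union>(S - {g})) \<in> ?L" by simp
    qed
    have "(\<Union>g\<in>S. x g) \<in> ?F" if x: "\<forall>g\<in>S. x g \<in> ?F \<and> x g \<subseteq> g" for x
    proof -
      have "S \<noteq> {}" using US f by auto
      have "(\<Union>g\<in>S. x g) = (\<Inter>g\<in>S. x g \<union> \<Union>(S - {g}))"
      proof
        show "(\<Union>g\<in>S. x g) \<subseteq> (\<Inter>g\<in>S. x g \<union> \<Union>(S - {g}))" using x by blast
        show "(\<Inter>g\<in>S. x g \<union> \<Union>(S - {g})) \<subseteq> (\<Union>g\<in>S. x g)"
        proof
          fix a assume a: "a \<in> (\<Inter>g\<in>S. x g \<union> \<Union>(S - {g}))"
          obtain k where k: "k \<in> S" "a \<in> k" using a \<open>S \<noteq> {}\<close> x by blast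
          then have "a \<notin> \<Union>(S - {k})" using part by blast
          then show "a \<in> (\<Union>g\<in>S. x g)" using a k by blast
        qed
      qed
      also have "\<dots> \<in> ?F" using \<open>S \<noteq> {}\<close> shrink x by (intro F.member_Inter) auto
      finally show ?thesis .
    qed
    then have "product_partition ?F f S" using dis US unfolding product_partition_def by blast
    moreover have "factors (G \<inter> ?F) f = S"
    proof
      show "S \<subseteq> factors (G \<inter> ?F) f" using SF unfolding S_def factors_def by blast
      show "factors (G \<inter> ?F) f \<subseteq> S"
      proof
        fix g assume g: "g \<in> factors (G \<inter> ?F) f"
        then have "g \<in> G" "g \<subseteq> f" unfolding factors_def by auto
        then obtain t where t: "t \<in> S" "g \<subseteq> t" using L.below_factor unfolding S_def by blast
        then have "t \<in> G \<inter> ?F" "t \<subseteq> f" using SF L.factorsD unfolding S_def by auto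
        then have "t = g" using t g unfolding factors_def by blast
        then show "g \<in> S" using t by simp
      qed
    qed
    ultimately show "product_partition ?F f (factors (G \<inter> ?F) f)" by simp
  qed
qed

end

section \<open>The amplitudes as rational functions\<close>

lemma sum_indet_nonzero:
  fixes f :: "'e::linorder set"
  assumes "finite f" "f \<noteq> {}"
  shows "(\<Sum>e\<in>f. indet e) \<noteq> 0"
proof -
  have "(\<Sum>e\<in>f. indet e) = Fract (\<Sum>e\<in>f. Poly_Mapping.single (Poly_Mapping.single e 1) 1) 1"
    using assms(1)
  proof (induction f rule: finite_induct)
    case empty
    then show ?case by (simp add: Zero_fract_def)
  next
    case (insert e f)
    then show ?case by (simp add: indet_def)
  qed
  moreover have "(\<Sum>e\<in>f. Poly_Mapping.single (Poly_Mapping.single e (1::nat)) (1::rat)) \<noteq> 0"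
  proof
    assume 0: "(\<Sum>e\<in>f. Poly_Mapping.single (Poly_Mapping.single e (1::nat)) (1::rat)) = 0"
    obtain d where d: "d \<in> f" using assms by blast
    have eq_iff: "Poly_Mapping.single e (1::nat) = Poly_Mapping.single d 1 \<longleftrightarrow> e = d" for e
      by (metis lookup_single_eq lookup_single_not_eq one_neq_zero)
    have "Poly_Mapping.lookup (\<Sum>e\<in>f. Poly_Mapping.single (Poly_Mapping.single e (1::nat)) (1::rat))
        (Poly_Mapping.single d 1) = (\<Sum>e\<in>f. if e = d then 1 else 0)"
      unfolding lookup_sum lookup_single eq_iff when_def ..
    also have "\<dots> = 1" using d assms(1) by simp
    finally show False unfolding 0 by simp
  qed
  ultimately show ?thesis by (simp add: Zero_fract_def eq_fract)
qed

theorem proposition2p17: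
  fixes E :: "'e::linorder set"
    and V :: "('e \<Rightarrow> int) set"
    and P :: "'e \<Rightarrow> int"
    and G :: "'e set set"
  assumes "oriented_matroid E V"
    and "loopless E V"
    and "tope V P"
    and "building_set (flat_lattice E V) G"
  shows "matroid_amplitude E V P indet =
    nestoid_amplitude (face_lattice E V P) (G \<inter> carrier (face_lattice E V P))
      (\<lambda>f. \<Sum>e\<in>f. indet e)"
proof -
  interpret oriented_matroid E V by fact
  let ?F = "flat_of E ` conformal P"
  have lattice: "face_lattice E V P = inclusion_order ?F"
    unfolding face_lattice_def conformal_def by simp
  have carrier: "carrier (inclusion_order F) = F" for F :: "'e set set"
    by (simp add: inclusion_order_def)
  have lless: "lless (inclusion_order F) = (\<subset>)" for F :: "'e set set"
    by (intro ext) (auto simp: lless_def inclusion_order_def)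
  interpret G: building_family E ?F "G \<inter> ?F"
    by (rule building_family_faces) fact+
  have P: "P \<in> V" "\<And>e. e \<in> E \<Longrightarrow> P e \<noteq> 0"
    using assms(3) tope_nonzero[OF assms(2,3)] unfolding tope_def by auto
  interpret L: closure_system E "flat_of E ` V" using P by (rule closure_system_flats)
  have EG: "E \<in> G" "E \<noteq> {}"
    using assms(4) unfolding flat_lattice_def building_set_def L.top_eq L.bottom_eq by auto
  have "matroid_amplitude E V P indet =
      nestoid_amplitude (inclusion_order ?F) (?F - {{}}) (\<lambda>f. \<Sum>e\<in>f. indet e)"
    unfolding matroid_amplitude_def lattice Let_def carrier lless G.bottom_eq G.top_eq
    by (rule G.maxchain_amplitude)
  also have "\<dots> = nestoid_amplitude (inclusion_order ?F) (G \<inter> ?F) (\<lambda>f. \<Sum>e\<in>f. indet e)"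
  proof (rule nestoid_amplitude_unique)
    show "building_family E ?F (?F - {{}})" by (rule G.building_family_all)
    show "building_family E ?F (G \<inter> ?F)" by (rule G.building_family_axioms)
    show "E \<in> ?F - {{}}" "E \<in> G \<inter> ?F" using EG G.ground_member by auto
    show "(\<Sum>e\<in>f. indet e) \<noteq> 0" if "f \<in> ?F" "f \<noteq> {}" for f
      using that G.finite_member by (intro sum_indet_nonzero)
    show "(\<Sum>e\<in>f. indet e) = (\<Sum>g\<in>S. \<Sum>e\<in>g. indet e)"
      if "finite f" "\<Union>S = f" "disjoint S" for f and S :: "'e set set"
    proof -
      have "\<forall>g\<in>S. finite g" using that(1,2) by (meson Union_upper finite_subset)
      then show ?thesis
        using that(3) sum.Union_disjoint[of S indet] unfolding that(2)[symmetric] disjoint_def by simp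
    qed
  qed
  finally show ?thesis unfolding lattice carrier .
qed

end
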